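(* Let $p \geqslant 3$ be a prime and let $G$ be a finite abelian $p$-group. If $\mathsf{D}(G)\leqslant 2\exp(G)-p^k$ for some integer $k \geqslant 0$ with $p^{k} \leqslant \exp(G)$, then $$\mathsf{s}(G)\leqslant\mathsf{D}(G)+2\exp(G)-p^k-1.$$
   Context: A sequence over a finite abelian group $G$ is a finite unordered list $S=g_1\cdots g_\ell$ of elements of $G$ with repetition allowed (an element of the free abelian monoid on $G$); $|S|=\ell$ is its length and $\sigma(S)=\sum_i g_i$ its sum; a subsequence $T\mid S$ is a sub-multiset. $\mathsf{D}(G)$ (Davenport constant) is the smallest positive integer $N$ such that every sequence over $G$ of length at least $N$ has a nonempty subsequence with sum $0$. $\mathsf{s}(G)$ (Erdős–Ginzburg–Ziv constant) is the smallest positive integer $N$ such that every sequence over $G$ of length at least $N$ has a subsequence $T$ with $\sigma(T)=0$ and $|T|=\exp(G)$. *)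

theory Defs
  imports
    "HOL-Algebra.Coset"
    "HOL-Algebra.FiniteProduct"
    "HOL-Computational_Algebra.Primes"
    "HOL-Library.Multiset"
begin

text \<open>
  Abelian groups are \<open>comm_group\<close>s of HOL-Algebra and hence written multiplicatively: the zero
  element, the sum and the multiples of the additive notation become \<open>\<one>\<close>, \<open>\<otimes>\<close> and \<open>[^]\<close>.
  A sequence over \<open>G\<close> is a multiset with elements in \<open>carrier G\<close>, and its subsequences are its
  sub-multisets.

  All sets of natural numbers whose \<open>LEAST\<close> element is taken below are nonempty if the group is
  finite.
\<close>

definition group_exponent :: "('a, 'b) monoid_scheme \<Rightarrow> nat" where
  "group_exponent G = (LEAST n. n > 0 \<and> (\<forall>x\<in>carrier G. x [^]\<^bsub>G\<^esub> n = \<one>\<^bsub>G\<^esub>))"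

definition sequence_over :: "('a, 'b) monoid_scheme \<Rightarrow> 'a multiset \<Rightarrow> bool" where
  "sequence_over G S \<longleftrightarrow> set_mset S \<subseteq> carrier G"

text \<open>The sum of all terms of \<open>S\<close>, each distinct term taken with its multiplicity.\<close>

definition seq_sum :: "('a, 'b) monoid_scheme \<Rightarrow> 'a multiset \<Rightarrow> 'a" where
  "seq_sum G S = (\<Otimes>\<^bsub>G\<^esub>g\<in>set_mset S. g [^]\<^bsub>G\<^esub> count S g)"

definition davenport_constant :: "('a, 'b) monoid_scheme \<Rightarrow> nat" where
  "davenport_constant G = (LEAST N. N > 0 \<and>
     (\<forall>S. sequence_over G S \<and> size S \<ge> N \<longrightarrow>
        (\<exists>T. T \<subseteq># S \<and> T \<noteq> {#} \<and> seq_sum G T = \<one>\<^bsub>G\<^esub>)))"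

definition egz_constant :: "('a, 'b) monoid_scheme \<Rightarrow> nat" where
  "egz_constant G = (LEAST N. N > 0 \<and>
     (\<forall>S. sequence_over G S \<and> size S \<ge> N \<longrightarrow>
        (\<exists>T. T \<subseteq># S \<and> seq_sum G T = \<one>\<^bsub>G\<^esub> \<and> size T = group_exponent G)))"

end

theory Submission
  imports Defs "HOL-Algebra.Multiplicative_Group" "HOL-Number_Theory.Cong"
begin

text \<open>
  Write \<open>n = exp(G)\<close>, \<open>q = p\<^sup>k\<close>, \<open>D = D(G)\<close>.  By Olson's theorem any product of \<open>D\<close> factors \<open>1 - g\<close>
  vanishes in the group ring over the field with \<open>p\<close> elements; counting pairs of a zero-sum
  subsequence and a \<open>j\<close>-subset of it, the sum of \<open>(-1)\<^bsup>|T|\<^esup> f(|T|)\<close> over all zero-sum subsequences \<open>T\<close>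
  of \<open>S\<close> is divisible by \<open>p\<close> whenever \<open>f\<close> is an integer-valued polynomial of degree at most
  \<open>|S| - D\<close>.

  Let \<open>|S| = D + 2n - q - 1\<close> and suppose that \<open>S\<close> has no zero-sum subsequence of length \<open>n\<close>, hence none
  of length \<open>3n\<close>.  Let \<open>a, b, c, e\<close> be the numbers of those of lengths \<open>n - q\<close>, \<open>2n - q\<close>, \<open>3n - q\<close>, \<open>2n\<close>.
  Modulo \<open>p\<close>, polynomials of degree \<open>n - 1\<close> detect a residue class modulo \<open>n\<close>, which gives \<open>e = -1\<close> and
  \<open>a - b + c = 0\<close>; as in Reiher's proof of Kemnitz' conjecture, double counting pairs of disjoint
  zero-sum subsequences of lengths \<open>n - q\<close> and \<open>2n\<close> gives \<open>a = c\<close>; and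
  \<open>f(x) = (x + n - 1 choose 2n - q - 1)\<close>, of the largest admissible degree, gives
  \<open>a - 2b + 3c - 2e = 0\<close>.  Together \<open>2 = 0\<close>, which is absurd as \<open>p\<close> is odd.
\<close>

section \<open>Binomial coefficients modulo a prime\<close>

text \<open>In \<open>y * (N choose y) = (N + 1 - y) * (N choose (y - 1))\<close> the right side is
  divisible by \<open>q\<close>. Were the binomial coefficient prime to \<open>p\<close>, all of
  \<open>q\<close> would have to divide \<open>y\<close>.\<close>

lemma prime_dvd_choose_prime_power_multiple:
  fixes p q N y :: nat
  assumes "prime p" "q = p ^ k" "q dvd N + 1 - y" "\<not> q dvd y" "0 < y" "y \<le> N"
  shows "p dvd N choose y"
proof (rule ccontr)
  assume "\<not> p dvd N choose y"
  hence "coprime (N choose y) q"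
    using assms(1,2) by (metis coprime_commute coprime_power_left_iff prime_imp_coprime)
  moreover have "y * (N choose y) = (N + 1 - y) * (N choose (y - 1))"
    using times_binomial_minus1_eq[OF assms(5), of N] binomial_absorb_comp[of N "y - 1"] assms(5,6)
    by simp
  hence "q dvd (N choose y) * y"
    using assms(3) by (metis dvd_mult2 mult.commute)
  ultimately have "q dvd y" by (metis coprime_commute coprime_dvd_mult_right_iff)
  thus False using assms(4) by simp
qed

lemma prime_dvd_choose_prime_power:
  fixes p n i :: nat
  assumes "prime p" "n = p ^ m" "0 < i" "i < n"
  shows "p dvd n choose i"
proof (rule ccontr)
  assume "\<not> p dvd n choose i"
  hence "coprime (n choose i) n"
    using assms(1,2) by (metis coprime_commute coprime_power_left_iff prime_imp_coprime)
  moreover have "n dvd (n choose i) * i"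
    using times_binomial_minus1_eq[OF assms(3), of n] by (metis dvd_triv_left mult.commute)
  ultimately have "n dvd i" by (metis coprime_commute coprime_dvd_mult_right_iff)
  thus False using assms(3,4) by (simp add: nat_dvd_not_less)
qed

text \<open>Coefficient comparison in (1 + X)^(n+N) = (1 + X^n) (1 + X)^N modulo \<open>p\<close>:
  in the Vandermonde sum only \<open>k = 0\<close> and \<open>k = n\<close> survive.\<close>

lemma choose_add_prime_power_cong:
  fixes p n N j :: nat
  assumes "prime p" "n = p ^ m"
  shows "[(n + N) choose j = (N choose j) + (if n \<le> j then N choose (j - n) else 0)] (mod p)"
proof -
  have n: "n > 0" using assms prime_gt_0_nat by simp
  have "[(\<Sum>k\<le>j. (n choose k) * (N choose (j - k)))
      = (\<Sum>k\<le>j. (if k = 0 then N choose j else 0) + (if k = n then N choose (j - n) else 0))] (mod p)"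
  proof (rule cong_sum)
    fix k
    show "[(n choose k) * (N choose (j - k))
       = (if k = 0 then N choose j else 0) + (if k = n then N choose (j - n) else 0)] (mod p)"
    proof (cases "0 < k \<and> k < n")
      case True
      thus ?thesis
        using prime_dvd_choose_prime_power[OF assms, of k] by (auto simp: cong_0_iff)
    next
      case False
      thus ?thesis using n by (cases "k = 0") (auto simp: binomial_eq_0)
    qed
  qed
  also have "(\<Sum>k\<le>j. (if k = 0 then N choose j else 0) + (if k = n then N choose (j - n) else 0))
     = (N choose j) + (if n \<le> j then N choose (j - n) else 0)"
    by (simp add: sum.distrib)
  finally show ?thesis by (simp add: vandermonde)
qed

lemma choose_mult_add_prime_power_cong:
  fixes p n v w z :: nat
  assumes "prime p" "n = p ^ m" "z < n"
  shows "[(v * n + w) choose z = w choose z] (mod p)"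
proof (induction v)
  case (Suc v)
  have "[(n + (v * n + w)) choose z = (v * n + w) choose z] (mod p)"
    using choose_add_prime_power_cong[OF assms(1,2), of "v * n + w" z] assms(3) by simp
  thus ?case using Suc by (metis add.assoc cong_trans mult_Suc)
qed simp

text \<open>Lucas' congruence in base \<open>n\<close> when the lower index has leading digit 1. The
  bound \<open>w < n\<close> makes the coefficient 0 at the start \<open>v = 0\<close>; each further
  \<open>n\<close> adds one copy of \<open>w choose z\<close>.\<close>

lemma choose_mult_add_prime_power_cong_carry:
  fixes p n v w z :: nat
  assumes "prime p" "n = p ^ m" "z < n" "w < n"
  shows "[(v * n + w) choose (n + z) = v * (w choose z)] (mod p)"
proof (induction v)
  case 0
  show ?case using assms by (simp add: binomial_eq_0)
next
  case (Suc v)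
  have "[(n + (v * n + w)) choose (n + z)
      = ((v * n + w) choose (n + z)) + ((v * n + w) choose z)] (mod p)"
    using choose_add_prime_power_cong[OF assms(1,2), of "v * n + w" "n + z"] by simp
  also have "[((v * n + w) choose (n + z)) + ((v * n + w) choose z)
      = v * (w choose z) + (w choose z)] (mod p)"
    using Suc choose_mult_add_prime_power_cong[OF assms(1-3)] by (intro cong_add)
  finally show ?case by (simp add: algebra_simps)
qed

text \<open>Only the last base-\<open>n\<close> digit of \<open>N\<close> matters, and it must be
  \<open>n - 1\<close>. Thus a polynomial of degree \<open>n - 1\<close> detects a residue class
  modulo \<open>n\<close>.\<close>

lemma choose_prime_power_minus_1_cong:
  fixes p n N :: nat
  assumes "prime p" "n = p ^ m"
  shows "[N choose (n - 1) = (if n dvd N + 1 then 1 else 0)] (mod p)"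
proof -
  have n: "n > 0" using assms prime_gt_0_nat by simp
  have "[(N div n * n + N mod n) choose (n - 1) = (N mod n) choose (n - 1)] (mod p)"
    using assms n by (intro choose_mult_add_prime_power_cong) auto
  moreover have "(N mod n) choose (n - 1) = (if N mod n = n - 1 then 1 else 0)"
    using n by (auto simp: binomial_eq_0 Suc_lessI less_Suc_eq_le)
      (metis Suc_pred less_antisym mod_less_divisor binomial_eq_0_iff)
  moreover have "N mod n = n - 1 \<longleftrightarrow> n dvd N + 1"
    using n by (metis Suc_eq_plus1 Suc_pred dvd_eq_mod_eq_0 mod_Suc nat.simps(3) diff_Suc_1)
  ultimately show ?thesis by simp
qed

text \<open>By Pascal's rule neighbours in row \<open>n - 1\<close> add up to an inner entry of row
  \<open>n\<close>, which is 0 modulo \<open>p\<close>; so the signs alternate from 1 on.\<close>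

lemma choose_prime_power_row_cong:
  fixes p n j :: nat
  assumes "prime p" "n = p ^ m" "j < n"
  shows "[int ((n - 1) choose j) = (-1) ^ j] (mod int p)"
  using assms(3)
proof (induction j)
  case (Suc j)
  have "n choose Suc j = ((n - 1) choose j) + ((n - 1) choose Suc j)"
    using Suc.prems by (cases n) auto
  moreover have "p dvd n choose Suc j"
    using prime_dvd_choose_prime_power[OF assms(1,2)] Suc.prems by simp
  ultimately have "[int ((n - 1) choose j) + int ((n - 1) choose Suc j) = 0] (mod int p)"
    by (metis cong_0_iff int_dvd_int_iff of_nat_add)
  moreover have "[int ((n - 1) choose j) = (-1) ^ j] (mod int p)"
    using Suc by simp
  ultimately have "[int ((n - 1) choose j) + int ((n - 1) choose Suc j) - int ((n - 1) choose j)
      = 0 - (-1) ^ j] (mod int p)"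
    by (rule cong_diff)
  thus ?case by simp
qed simp

lemma choose_prime_power_diff_cong:
  fixes p n q w :: nat
  assumes p: "prime p" "odd p" and n: "n = p ^ m" and q: "q = p ^ k" and qn: "q < n" and w: "w < n"
  shows "[int (w choose (n - q - 1))
      = (if w = n - 1 then -1 else if w = n - q - 1 then 1 else 0)] (mod int p)"
proof -
  have q0: "q > 0" using p q prime_gt_0_nat by simp
  have "k \<le> m" using qn p prime_gt_1_nat n q by (metis less_imp_le power_less_imp_less_exp)
  hence qdvd: "q dvd n" using n q by (simp add: le_imp_power_dvd)
  consider "w = n - 1" | "w < n - q - 1" | "w = n - q - 1" | "n - q - 1 < w" "w < n - 1"
    using w by linarith
  thus ?thesis
  proof cases
    case 1
    \<comment> \<open>The sign -1 comes from \<open>n - q - 1\<close> being odd.\<close>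
    have "odd n" "odd q" using p n q by auto
    hence "odd (n - q - 1)" using qn by (simp add: odd_Suc_minus_one less_imp_le)
    thus ?thesis using 1 choose_prime_power_row_cong[OF p(1) n, of "n - q - 1"] qn by simp
  next
    case 2
    thus ?thesis using q0 by (auto simp: binomial_eq_0)
  next
    case 3
    thus ?thesis using q0 qn by auto
  next
    case 4
    \<comment> \<open>The complementary lower index \<open>y\<close> satisfies
      \<open>w + 1 - y = n - q\<close>, a multiple of \<open>q\<close>, while 0 < \<open>y\<close> <
      \<open>q\<close>.\<close>
    define y where "y = w - (n - q - 1)"
    have y: "0 < y" "y < q" "y \<le> w" "w + 1 - y = n - q" using 4 qn by (auto simp: y_def)
    have "p dvd w choose y"
      using y qdvd qn by (intro prime_dvd_choose_prime_power_multiple[OF p(1) q])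
        (auto simp: nat_dvd_not_less)
    moreover have "w choose y = w choose (n - q - 1)"
      using 4 by (subst binomial_symmetric) (auto simp: y_def)
    ultimately show ?thesis using 4 by (auto simp: cong_0_iff)
  qed
qed

text \<open>Write \<open>i + (n - 1)\<close> as \<open>v * n + w\<close> with \<open>w < n\<close>.
  The last digit \<open>w\<close> is \<open>n - 1\<close> or \<open>n - q - 1\<close> exactly for
  the two residue classes of \<open>i\<close>, and the carry contributes the factor
  \<open>v\<close>, which is the quotient shown.\<close>

lemma choose_two_residues_cong:
  fixes p n q i :: nat
  assumes p: "prime p" "odd p" and n: "n = p ^ m" and q: "q = p ^ k" and qn: "q < n"
  shows "[int ((i + (n - 1)) choose (2 * n - q - 1))
      = (if n dvd i then - int (i div n) else if n dvd i + q then int ((i + q) div n) else 0)]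
      (mod int p)"
proof -
  have q0: "q > 0" using p q prime_gt_0_nat by simp
  have split: "2 * n - q - 1 = n + (n - q - 1)" using qn by simp
  have eval: "[int ((v * n + w) choose (2 * n - q - 1))
      = int v * (if w = n - 1 then -1 else if w = n - q - 1 then 1 else 0)] (mod int p)"
    if "w < n" for v w
  proof -
    have "[int ((v * n + w) choose (n + (n - q - 1))) = int (v * (w choose (n - q - 1)))] (mod int p)"
      using choose_mult_add_prime_power_cong_carry[OF p(1) n, of "n - q - 1" w v] that qn q0
      by (simp only: cong_int_iff)
    moreover have "[int v * int (w choose (n - q - 1))
      = int v * (if w = n - 1 then -1 else if w = n - q - 1 then 1 else 0)] (mod int p)"
      by (intro cong_mult cong_refl choose_prime_power_diff_cong[OF p n q qn that])
    ultimately show ?thesis unfolding split of_nat_mult by (rule cong_trans)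
  qed
  show ?thesis
  proof (cases "n dvd i")
    case True
    then obtain u where u: "i = u * n" by (metis dvd_def mult.commute)
    show ?thesis using eval[of "n - 1" u] u qn by simp
  next
    case ni: False
    show ?thesis
    proof (cases "n dvd i + q")
      case True
      then obtain u where u: "i + q = u * n" by (metis dvd_def mult.commute)
      hence "i + (n - 1) = u * n + (n - q - 1)" using qn q0 by linarith
      moreover have "n - q - 1 \<noteq> n - 1" using qn q0 by simp
      ultimately show ?thesis using eval[of "n - q - 1" u] u ni qn True by simp
    next
      case False
      define v w where "v = (i + (n - 1)) div n" and "w = (i + (n - 1)) mod n"
      have vw: "i + (n - 1) = v * n + w" "w < n" using qn by (auto simp: v_def w_def)
      have "w \<noteq> n - 1"
      proof
        assume "w = n - 1"
        hence "i = v * n" using vw by simp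
        thus False using ni by simp
      qed
      moreover have "w \<noteq> n - q - 1"
      proof
        assume "w = n - q - 1"
        hence "i + q = v * n" using vw qn q0 by linarith
        thus False using False by simp
      qed
      ultimately show ?thesis using eval[OF vw(2), of v] vw(1) ni False by simp
    qed
  qed
qed


section \<open>Difference operators\<close>

lemma ex_submset_size:
  assumes "n \<le> size M"
  obtains N where "N \<subseteq># M" "size N = n"
proof -
  obtain xs where xs: "mset xs = M" using ex_mset by blast
  have "mset (take n xs) \<subseteq># M"
    unfolding xs[symmetric] by (metis append_take_drop_id mset_append mset_subset_eq_add_left)
  moreover have "size (mset (take n xs)) = n" using assms xs by auto
  ultimately show ?thesis using that by blast
qed

context comm_group
begin

text \<open>
  The action of the group ring element \<open>1 - g\<close> on functions.  The guard makes these operators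
  commute unconditionally, as folding over a multiset requires.
\<close>

definition diff_op :: "'a \<Rightarrow> ('a \<Rightarrow> int) \<Rightarrow> 'a \<Rightarrow> int" where
  "diff_op g f x = (if g \<in> carrier G \<and> x \<in> carrier G then f x - f (g \<otimes> x) else 0)"

definition diffs :: "'a multiset \<Rightarrow> ('a \<Rightarrow> int) \<Rightarrow> 'a \<Rightarrow> int" where
  "diffs M f = fold_mset diff_op f M"

text \<open>For \<open>M\<close> over the group and \<open>p\<close> prime: the product of all 1 - g
  with g in \<open>M\<close> is zero in the group ring over the field with \<open>p\<close>
  elements, expressed through its action on functions.\<close>

definition annihilating :: "nat \<Rightarrow> 'a multiset \<Rightarrow> bool" where
  "annihilating p M \<longleftrightarrow> (\<forall>f. \<forall>x\<in>carrier G. int p dvd diffs M f x)"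

lemma comp_fun_commute_diff_op: "comp_fun_commute diff_op"
  by unfold_locales (auto simp: fun_eq_iff diff_op_def m_lcomm)

lemma diffs_empty [simp]: "diffs {#} f = f"
  by (simp add: diffs_def)

lemma diffs_add_mset [simp]: "diffs (add_mset g M) f = diff_op g (diffs M f)"
  by (simp add: diffs_def comp_fun_commute.fold_mset_add_mset[OF comp_fun_commute_diff_op])

lemma diffs_replicate_mset:
  assumes "g \<in> carrier G" "x \<in> carrier G"
  shows "diffs (replicate_mset n g) f x = (\<Sum>j\<le>n. (-1) ^ j * int (n choose j) * f (g [^] j \<otimes> x))"
  using assms(2)
proof (induction n arbitrary: x)
  case (Suc n)
  define F where "F j = f (g [^] j \<otimes> x)" for j :: nat
  have F: "f (g [^] j \<otimes> (g \<otimes> x)) = F (Suc j)" for j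
    using assms(1) Suc.prems by (simp add: F_def m_assoc)
  \<comment> \<open>An index shift; the added term at \<open>Suc n\<close> has coefficient
    0.\<close>
  have *: "(\<Sum>j\<le>n. (-1) ^ j * int (n choose Suc j) * F (Suc j))
      = f x - (\<Sum>j\<le>n. (-1) ^ j * int (n choose j) * F j)"
  proof -
    have "(\<Sum>j\<le>n. (-1) ^ j * int (n choose j) * F j)
       = (\<Sum>j\<le>Suc n. (-1) ^ j * int (n choose j) * F j)" by simp
    also have "\<dots> = f x - (\<Sum>j\<le>n. (-1) ^ j * int (n choose Suc j) * F (Suc j))"
      by (subst sum.atMost_Suc_shift) (simp add: F_def Suc.prems sum_negf)
    finally show ?thesis by simp
  qed
  have "(\<Sum>j\<le>Suc n. (-1) ^ j * int (Suc n choose j) * F j)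
      = f x - (\<Sum>j\<le>n. (-1) ^ j * int (n choose j) * F (Suc j))
        - (\<Sum>j\<le>n. (-1) ^ j * int (n choose Suc j) * F (Suc j))"
    by (subst sum.atMost_Suc_shift)
      (simp add: F_def Suc.prems sum_negf sum_subtractf algebra_simps sum.distrib del: sum.atMost_Suc)
  also have "\<dots> = (\<Sum>j\<le>n. (-1) ^ j * int (n choose j) * F j)
        - (\<Sum>j\<le>n. (-1) ^ j * int (n choose j) * F (Suc j))"
    using * by simp
  also have "\<dots> = diffs (replicate_mset (Suc n) g) f x"
    using assms Suc.prems F by (simp add: diff_op_def Suc.IH F_def)
  finally show ?case by (simp add: F_def)
qed simp

text \<open>Multiplying out the factors 1 - g_i: a new index splits the subsets into those with and
  without it, the former with opposite sign. Indices keep equal terms apart.\<close>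

lemma diffs_image_mset:
  assumes "finite I" "g \<in> I \<rightarrow> carrier G" "x \<in> carrier G"
  shows "diffs (image_mset g (mset_set I)) f x
    = (\<Sum>J\<in>Pow I. (-1) ^ card J * f (finprod G g J \<otimes> x))"
  using assms
proof (induction I arbitrary: x rule: finite_induct)
  case (insert i I)
  have gi: "g i \<in> carrier G" and gI: "g \<in> I \<rightarrow> carrier G" using insert.prems by auto
  have "Pow (insert i I) = Pow I \<union> insert i ` Pow I" by (simp add: Pow_insert)
  moreover have "inj_on (insert i) (Pow I)"
    using insert.hyps by (intro inj_onI) (auto simp: insert_ident)
  moreover have "Pow I \<inter> insert i ` Pow I = {}" using insert.hyps by auto
  moreover have "finite (Pow I)" using insert.hyps by simp
  ultimately have "(\<Sum>J\<in>Pow (insert i I). (-1) ^ card J * f (finprod G g J \<otimes> x))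
     = (\<Sum>J\<in>Pow I. (-1) ^ card J * f (finprod G g J \<otimes> x))
       + (\<Sum>J\<in>Pow I. (-1) ^ card (insert i J) * f (finprod G g (insert i J) \<otimes> x))"
    by (simp add: sum.union_disjoint sum.reindex)
  also have "(\<Sum>J\<in>Pow I. (-1) ^ card (insert i J) * f (finprod G g (insert i J) \<otimes> x))
    = (\<Sum>J\<in>Pow I. - ((-1) ^ card J * f (finprod G g J \<otimes> (g i \<otimes> x))))"
  proof (rule sum.cong)
    fix J assume J: "J \<in> Pow I"
    hence fin: "finite J" and i: "i \<notin> J" and gJ: "g \<in> J \<rightarrow> carrier G"
      using insert.hyps gI by (auto intro: finite_subset)
    have "finprod G g (insert i J) \<otimes> x = finprod G g J \<otimes> (g i \<otimes> x)"
      using fin i gJ gi insert.prems by (simp add: m_ac finprod_closed)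
    thus "(-1) ^ card (insert i J) * f (finprod G g (insert i J) \<otimes> x)
       = - ((-1) ^ card J * f (finprod G g J \<otimes> (g i \<otimes> x)))"
      using fin i by simp
  qed simp
  also have "(\<Sum>J\<in>Pow I. (-1) ^ card J * f (finprod G g J \<otimes> x))
       + (\<Sum>J\<in>Pow I. - ((-1) ^ card J * f (finprod G g J \<otimes> (g i \<otimes> x))))
     = diffs (image_mset g (mset_set (insert i I))) f x"
    using insert gi gI by (simp add: diff_op_def sum_negf)
  finally show ?case by simp
qed simp

section \<open>Vanishing products in the group ring modulo p\<close>

lemma annihilating_add_mset: "annihilating p M \<Longrightarrow> annihilating p (add_mset g M)"
  by (auto simp: annihilating_def diff_op_def)

lemma annihilating_mono:
  assumes "annihilating p M" "M \<subseteq># N"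
  shows "annihilating p N"
proof -
  obtain K where "N = M + K" using assms(2) by (metis subset_mset.le_iff_add)
  moreover have "annihilating p (M + K)" for K
    using assms(1) by (induction K) (auto intro: annihilating_add_mset)
  ultimately show ?thesis by simp
qed

text \<open>This is \<open>1 - gh = (1 - g) + g(1 - h)\<close>.\<close>

lemma annihilating_mult:
  assumes "annihilating p (add_mset g M)" "annihilating p (add_mset h M)"
    and "g \<in> carrier G" "h \<in> carrier G"
  shows "annihilating p (add_mset (g \<otimes> h) M)"
proof -
  have "diffs (add_mset (g \<otimes> h) M) f x
      = diffs (add_mset g M) f x + diffs (add_mset h M) f (g \<otimes> x)" if "x \<in> carrier G" for f x
    using assms(3,4) that by (simp add: diff_op_def m_ac)
  thus ?thesis using assms by (auto simp: annihilating_def)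
qed

lemma annihilating_one: "annihilating p (add_mset \<one> M)"
  by (auto simp: annihilating_def diff_op_def)

lemma annihilating_pow:
  assumes "annihilating p (add_mset g M)" "g \<in> carrier G"
  shows "annihilating p (add_mset (g [^] (j::nat)) M)"
  using assms by (induction j) (auto intro: annihilating_mult annihilating_one)

text \<open>In characteristic \<open>p\<close>, (1 - g)^q = 1 - g^q = 0: only \<open>j = 0\<close>
  and \<open>j = q\<close> survive, and they cancel because \<open>q\<close> is odd.\<close>

lemma annihilating_replicate_mset:
  assumes "prime p" "odd p" "q = p ^ m" "g \<in> carrier G" "g [^] q = \<one>"
  shows "annihilating p (replicate_mset q g)"
  unfolding annihilating_def
proof (intro allI ballI)
  fix f :: "'a \<Rightarrow> int" and x assume x: "x \<in> carrier G"
  have q: "q > 0" "odd q" using assms prime_gt_0_nat by auto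
  have "[(\<Sum>j\<le>q. (-1) ^ j * int (q choose j) * f (g [^] j \<otimes> x))
      = (\<Sum>j\<le>q. (if j = 0 then f x else 0) + (if j = q then - f x else 0))] (mod int p)"
  proof (rule cong_sum)
    fix j
    show "[(-1) ^ j * int (q choose j) * f (g [^] j \<otimes> x)
      = (if j = 0 then f x else 0) + (if j = q then - f x else 0)] (mod int p)"
    proof (cases "0 < j \<and> j < q")
      case True
      hence "int p dvd int (q choose j)"
        using prime_dvd_choose_prime_power[OF assms(1,3), of j] by simp
      thus ?thesis using True by (auto simp: cong_0_iff)
    next
      case False
      thus ?thesis using q x assms(5) by (cases "j = 0"; cases "j = q") (auto simp: binomial_eq_0)
    qed
  qed
  thus "int p dvd diffs (replicate_mset q g) f x"
    using q by (simp add: diffs_replicate_mset assms(4) x sum.distrib cong_0_iff)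
qed

text \<open>For a subgroup \<open>H\<close> and \<open>p\<close> prime: the \<open>d\<close>-th
  power of the augmentation ideal of the group ring of \<open>H\<close> over the field with
  \<open>p\<close> elements is zero.\<close>

definition annihilation_bound :: "nat \<Rightarrow> 'a set \<Rightarrow> nat \<Rightarrow> bool" where
  "annihilation_bound p H d \<longleftrightarrow> (\<forall>M. set_mset M \<subseteq> H \<and> d \<le> size M \<longrightarrow> annihilating p M)"

text \<open>Factors from \<open>H\<close> are traded one at a time for factors from
  \<open>Y\<close>. In the induction \<open>M\<close> holds those still to be traded and
  \<open>N\<close> those already in \<open>Y\<close>, the total staying at \<open>e\<close>.\<close>

lemma annihilation_bound_generators:
  assumes "\<And>M. set_mset M \<subseteq> Y \<Longrightarrow> size M = e \<Longrightarrow> annihilating p M"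
    and "\<And>M h. h \<in> H \<Longrightarrow> (\<And>y. y \<in> Y \<Longrightarrow> annihilating p (add_mset y M))
            \<Longrightarrow> annihilating p (add_mset h M)"
  shows "annihilation_bound p H e"
proof -
  have *: "annihilating p (M + N)" if "set_mset M \<subseteq> H" "set_mset N \<subseteq> Y" "size M + size N = e" for M N
    using that
  proof (induction M arbitrary: N)
    case empty
    thus ?case using assms(1) by simp
  next
    case (add h M)
    have "annihilating p (add_mset y (M + N))" if "y \<in> Y" for y
      using add.IH[of "add_mset y N"] add.prems that by auto
    moreover have "h \<in> H" using add.prems(1) by simp
    ultimately have "annihilating p (add_mset h (M + N))" using assms(2) by blast
    thus ?case by simp
  qed
  show ?thesis unfolding annihilation_bound_def
  proof (intro allI impI)
    fix M assume M: "set_mset M \<subseteq> H \<and> e \<le> size M"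
    obtain N where "N \<subseteq># M" "size N = e"
      using M ex_submset_size by blast
    moreover have "set_mset N \<subseteq> H" using M \<open>N \<subseteq># M\<close> set_mset_mono by blast
    ultimately show "annihilating p M" using *[of N "{#}"] annihilating_mono by simp
  qed
qed

text \<open>Pigeonhole on factors from \<open>insert g K\<close>: among \<open>d + (q - 1)\<close>
  of them, \<open>g\<close> occurs at least \<open>q\<close> times or at least \<open>d\<close> lie
  in \<open>K\<close>.\<close>

lemma annihilation_bound_cyclic_mult:
  assumes p: "prime p" "odd p" "q = p ^ m" and g: "g \<in> carrier G" "g [^] q = \<one>"
    and K: "K \<subseteq> carrier G" "\<one> \<in> K" "annihilation_bound p K d"
  shows "annihilation_bound p {g [^] a \<otimes> k | (a::nat) k. k \<in> K} (d + (q - 1))"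
proof (rule annihilation_bound_generators[where Y = "insert g K"])
  fix M assume M: "set_mset M \<subseteq> insert g K" "size M = d + (q - 1)"
  define A B where "A = {#y \<in># M. y = g#}" and "B = {#y \<in># M. y \<noteq> g#}"
  have AB: "M = A + B" "A = replicate_mset (count M g) g" "set_mset B \<subseteq> K"
    using M multiset_partition[of M "\<lambda>y. y = g"] by (auto simp: A_def B_def filter_eq_replicate_mset)
  show "annihilating p M"
  proof (cases "q \<le> count M g")
    case True
    hence "replicate_mset q g \<subseteq># M" by (simp add: count_le_replicate_mset_subset_eq)
    thus ?thesis using annihilating_replicate_mset[OF p g] annihilating_mono by blast
  next
    case False
    have "size M = count M g + size B" using AB by (metis size_union size_replicate_mset)
    hence "d \<le> size B" using M(2) False by simp
    hence "annihilating p B" using K(3) AB(3) by (simp add: annihilation_bound_def)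
    thus ?thesis using AB(1) annihilating_mono[of p B M] by simp
  qed
next
  fix M h assume h: "h \<in> {g [^] a \<otimes> k | (a::nat) k. k \<in> K}"
    and *: "\<And>y. y \<in> insert g K \<Longrightarrow> annihilating p (add_mset y M)"
  thus "annihilating p (add_mset h M)"
    using g K by (auto intro!: annihilating_mult annihilating_pow)
qed


section \<open>The Davenport constant of a p-group\<close>

lemma seq_sum_empty [simp]: "seq_sum G {#} = \<one>"
  by (simp add: seq_sum_def)

lemma seq_sum_add_mset [simp]:
  assumes "x \<in> carrier G" "set_mset M \<subseteq> carrier G"
  shows "seq_sum G (add_mset x M) = x \<otimes> seq_sum G M"
proof -
  define A where "A = set_mset M - {x}"
  define P where "P = (\<Otimes>g\<in>A. g [^] count M g)"
  have A: "finite A" "x \<notin> A" "A \<subseteq> carrier G" using assms by (auto simp: A_def)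
  have P: "P \<in> carrier G" using A by (auto simp: P_def intro!: finprod_closed)
  have 1: "seq_sum G M = x [^] count M x \<otimes> P"
  proof (cases "x \<in># M")
    case True
    hence "set_mset M = insert x A" by (auto simp: A_def)
    thus ?thesis using A assms by (simp add: seq_sum_def P_def Pi_iff subset_iff)
  next
    case False
    hence "set_mset M = A" "count M x = 0" by (auto simp: A_def not_in_iff)
    thus ?thesis using P by (simp add: seq_sum_def P_def)
  qed
  have "set_mset (add_mset x M) = insert x A" by (auto simp: A_def)
  hence "seq_sum G (add_mset x M)
     = x [^] Suc (count M x) \<otimes> (\<Otimes>g\<in>A. g [^] count (add_mset x M) g)"
    using A assms by (simp add: seq_sum_def Pi_iff subset_iff)
  also have "(\<Otimes>g\<in>A. g [^] count (add_mset x M) g) = P"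
    unfolding P_def using A by (intro finprod_cong') (auto simp: subset_iff)
  finally show ?thesis using 1 P assms by (simp add: m_ac)
qed

lemma seq_sum_closed [simp]: "set_mset M \<subseteq> carrier G \<Longrightarrow> seq_sum G M \<in> carrier G"
  by (induction M) auto

lemma seq_sum_union:
  assumes "set_mset M \<subseteq> carrier G" "set_mset N \<subseteq> carrier G"
  shows "seq_sum G (M + N) = seq_sum G M \<otimes> seq_sum G N"
  using assms by (induction M) (auto simp: m_assoc)

lemma seq_sum_replicate_mset:
  assumes "g \<in> carrier G"
  shows "seq_sum G (replicate_mset n g) = g [^] n"
  using assms by (induction n) (auto simp: m_comm)

lemma seq_sum_image_mset:
  assumes "finite I" "g \<in> I \<rightarrow> carrier G"
  shows "seq_sum G (image_mset g (mset_set I)) = finprod G g I"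
  using assms
proof (induction I rule: finite_induct)
  case (insert i I)
  hence "g i \<in> carrier G" "set_mset (image_mset g (mset_set I)) \<subseteq> carrier G" by auto
  thus ?case using insert by (simp del: set_image_mset)
qed simp

lemma seq_sum_mem_subgroup:
  assumes "subgroup H G" "set_mset M \<subseteq> H"
  shows "seq_sum G M \<in> H"
proof -
  have "H \<subseteq> carrier G" using assms(1) by (rule subgroup.subset)
  with assms(2) show ?thesis
  proof (induction M)
    case empty
    show ?case using subgroup.one_closed[OF assms(1)] by simp
  next
    case (add x M)
    hence "x \<in> carrier G" "set_mset M \<subseteq> carrier G" by auto
    thus ?case using add subgroup.m_closed[OF assms(1)] by simp
  qed
qed

section \<open>Splitting off a cyclic factor of maximal order\<close>

lemma subgroup_nat_pow_closed:
  assumes "subgroup H G" "x \<in> H"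
  shows "x [^] (n::nat) \<in> H"
  using assms by (induction n) (auto simp: subgroup.one_closed subgroup.m_closed)

text \<open>The powers of \<open>x\<close> with exponents 1, p, p^2, ... end at the identity, hence
  in \<open>L\<close>; take the last one before \<open>L\<close> is first entered.\<close>

lemma p_group_step_outside_subgroup:
  assumes "order G = p ^ N" "subgroup L G" "x \<in> carrier G" "x \<notin> L"
  obtains j :: nat where "x [^] j \<notin> L" "(x [^] j) [^] p \<in> L"
proof -
  define t where "t = (LEAST t. x [^] (p ^ t) \<in> L)"
  have "x [^] (p ^ N) \<in> L"
    using pow_order_eq_1[OF assms(3)] assms(1) subgroup.one_closed[OF assms(2)] by simp
  hence t: "x [^] (p ^ t) \<in> L" unfolding t_def by (rule LeastI)
  have "t \<noteq> 0" using t assms(3,4) by (cases t) auto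
  then obtain s where s: "t = Suc s" using not0_implies_Suc by blast
  have "x [^] (p ^ s) \<notin> L" using not_less_Least[of s "\<lambda>t. x [^] (p ^ t) \<in> L"] s by (simp add: t_def)
  moreover have "(x [^] (p ^ s)) [^] p \<in> L"
    using t s assms(3) by (simp add: nat_pow_pow mult.commute)
  ultimately show ?thesis by (rule that)
qed

text \<open>A subgroup \<open>K\<close> maximal among those meeting \<open>\<langle>g\<rangle>\<close> trivially is a complement.\<close>

lemma cyclic_complement:
  assumes p: "prime p" and fin: "finite (carrier G)" and ord: "order G = p ^ N"
    and H: "subgroup H G" and g: "g \<in> H" and max: "\<And>x. x \<in> H \<Longrightarrow> x [^] ord g = \<one>"
  obtains K where "subgroup K G" "K \<subseteq> H" "\<And>a::nat. g [^] a \<in> K \<Longrightarrow> g [^] a = \<one>"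
    "H = {g [^] a \<otimes> k | (a::nat) k. k \<in> K}"
proof -
  have HG: "H \<subseteq> carrier G" using H by (rule subgroup.subset)
  have gG: "g \<in> carrier G" using g HG by blast
  define \<K> where "\<K> = {K. subgroup K G \<and> K \<subseteq> H \<and> (\<forall>a::nat. g [^] a \<in> K \<longrightarrow> g [^] a = \<one>)}"
  have "finite \<K>"
    by (rule finite_subset[of _ "Pow (carrier G)"]) (use fin HG in \<open>auto simp: \<K>_def\<close>)
  moreover have "{\<one>} \<in> \<K>"
    using triv_subgroup subgroup.one_closed[OF H] by (auto simp: \<K>_def)
  ultimately obtain K where "K \<in> \<K>" and Kmax: "\<And>K'. K' \<in> \<K> \<Longrightarrow> K \<subseteq> K' \<Longrightarrow> K = K'"
    using finite_has_maximal[of \<K>] by blast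
  hence K: "subgroup K G" "K \<subseteq> H" "\<And>a::nat. g [^] a \<in> K \<Longrightarrow> g [^] a = \<one>"
    by (auto simp: \<K>_def)
  have KG: "K \<subseteq> carrier G" using K(2) HG by blast
  define L where "L = generate G {g} <#> K"
  have L: "subgroup L G" unfolding L_def
    using mult_subgroups generate_is_subgroup gG K(1) by simp
  have Leq: "L = {g [^] a \<otimes> k | (a::nat) k. k \<in> K}"
    unfolding L_def generate_pow_on_finite_carrier[OF fin gG] set_mult_def by auto
  have KL: "K \<subseteq> L"
  proof
    fix k assume "k \<in> K"
    thus "k \<in> L" using KG by (auto simp: Leq intro!: exI[of _ "0::nat"] exI[of _ k])
  qed
  have gL: "g [^] (a::nat) \<in> L" for a
    using subgroup.one_closed[OF K(1)] gG by (auto simp: Leq intro!: exI[of _ a] exI[of _ \<one>])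
  have "L \<subseteq> H"
    using K(2) by (auto simp: Leq intro!: subgroup.m_closed[OF H] subgroup_nat_pow_closed[OF H] g)
  moreover have "H \<subseteq> L"
  proof (rule ccontr)
    assume "\<not> H \<subseteq> L"
    \<comment> \<open>An element outside \<open>L\<close> will be corrected by a power of
      \<open>g\<close> to some \<open>y\<close> whose adjunction to \<open>K\<close> contradicts
      maximality.\<close>
    then obtain x0 where x0: "x0 \<in> H" "x0 \<notin> L" by blast
    then obtain j where "x0 [^] (j::nat) \<notin> L" "(x0 [^] j) [^] p \<in> L"
      using p_group_step_outside_subgroup[OF ord L] HG by blast
    then obtain x where x: "x \<in> H" "x \<notin> L" "x [^] p \<in> L"
      using subgroup_nat_pow_closed[OF H x0(1)] by blast
    then obtain a k where ak: "x [^] p = g [^] (a::nat) \<otimes> k" "k \<in> K" by (auto simp: Leq)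
    have xG: "x \<in> carrier G" and kG: "k \<in> carrier G" using x HG ak KG by auto
    have "ord g \<noteq> 1"
      using max[OF x(1)] xG x(2) subgroup.one_closed[OF L] by auto
    moreover have "ord g dvd p ^ N" using ord_dvd_group_order[OF gG] ord by simp
    ultimately obtain r where r: "ord g = p * r"
      using p by (metis divides_primepow_nat dvd_def gr0_conv_Suc power_0 power_Suc not_gr_zero)
    have r0: "r > 0" using r ord_ge_1[OF fin gG] by (cases r) auto
    \<comment> \<open>Raising \<open>x [^] p = g [^] a \<otimes> k\<close> to the power
      \<open>r\<close> puts \<open>g [^] (a * r)\<close> into \<open>K\<close>, so it is trivial and
      \<open>p\<close> divides \<open>a\<close>.\<close>
    have "\<one> = (x [^] p) [^] r" using max[OF x(1)] r xG by (simp add: nat_pow_pow)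
    also have "\<dots> = g [^] (a * r) \<otimes> k [^] r"
      using ak gG kG by (simp add: nat_pow_distrib nat_pow_pow)
    finally have "g [^] (a * r) = inv (k [^] r)"
      using gG kG by (metis inv_equality nat_pow_closed)
    hence "g [^] (a * r) \<in> K"
      using subgroup.m_inv_closed[OF K(1)] subgroup_nat_pow_closed[OF K(1) ak(2)] by simp
    hence "g [^] (a * r) = \<one>" by (rule K(3))
    hence "p * r dvd a * r" using pow_eq_id[OF gG] r by simp
    then obtain b where b: "a = p * b" using r0 by (auto simp: dvd_def)
    \<comment> \<open>Removing the \<open>p\<close>-th root \<open>g [^] b\<close> of
      \<open>g [^] a\<close> leaves \<open>y\<close> outside \<open>L\<close> with
      \<open>y [^] p = k\<close> in \<open>K\<close>.\<close>
    define y where "y = x \<otimes> inv (g [^] b)"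
    have yG: "y \<in> carrier G" and yH: "y \<in> H"
      using xG gG x(1) g by (auto simp: y_def intro!: subgroup.m_closed[OF H]
          subgroup.m_inv_closed[OF H] subgroup_nat_pow_closed[OF H])
    have xy: "x = y \<otimes> g [^] b" using xG gG by (simp add: y_def m_assoc)
    have yL: "y \<notin> L" using x(2) gL xy subgroup.m_closed[OF L] by auto
    have "g [^] a \<otimes> y [^] p = g [^] a \<otimes> k"
      using ak(1) xy yG gG by (simp add: nat_pow_distrib nat_pow_pow b m_comm mult.commute)
    hence yp: "y [^] p = k" using gG yG kG by simp
    define K' where "K' = generate G {y} <#> K"
    have K': "subgroup K' G" unfolding K'_def
      using mult_subgroups generate_is_subgroup yG K(1) by simp
    have K'eq: "K' = {y [^] j \<otimes> k | (j::nat) k. k \<in> K}"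
      unfolding K'_def generate_pow_on_finite_carrier[OF fin yG] set_mult_def by auto
    have "g [^] c = \<one>" if c: "g [^] c \<in> K'" for c :: nat
    proof -
      obtain j k' where j: "g [^] c = y [^] (j::nat) \<otimes> k'" "k' \<in> K" using c by (auto simp: K'eq)
      have k'G: "k' \<in> carrier G" using j KG by blast
      show ?thesis
      proof (cases "p dvd j")
        case True
        then obtain i where "j = p * i" by blast
        hence "y [^] j = k [^] i" using yp yG by (simp add: nat_pow_pow[symmetric])
        hence "g [^] c \<in> K"
          using j ak(2) by (simp add: subgroup.m_closed[OF K(1)] subgroup_nat_pow_closed[OF K(1)])
        thus ?thesis by (rule K(3))
      next
        case False
        \<comment> \<open>With \<open>i\<close> inverse to \<open>j\<close> modulo \<open>p\<close>,
          \<open>y [^] (j * i)\<close> is \<open>y\<close> times a power of \<open>k\<close>. As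
          \<open>y [^] j\<close> lies in \<open>L\<close>, so would \<open>y\<close>.\<close>
        hence "coprime j p" using p by (metis coprime_commute prime_imp_coprime)
        moreover have "1 < p" using p by (rule prime_gt_1_nat)
        ultimately obtain i where i: "[j * i = 1] (mod p)"
          using cong_solve_coprime_nat by fastforce
        then obtain s where s: "j * i = 1 + p * s"
          using \<open>1 < p\<close> by (metis cong_to_1'_nat less_one mult.commute not_less_iff_gr_or_eq mult_0_right add.commute)
        have "y [^] j = g [^] c \<otimes> inv k'"
          using j k'G gG yG by (simp add: m_assoc)
        hence "y [^] j \<in> L"
          using gL KL j(2) by (auto intro!: subgroup.m_closed[OF L] subgroup.m_inv_closed[OF L])
        hence "y [^] (j * i) \<in> L"
          using subgroup_nat_pow_closed[OF L, of "y [^] j" i] yG by (simp add: nat_pow_pow)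
        moreover have "y [^] (j * i) = y \<otimes> k [^] s"
          unfolding s using yp yG kG by (simp add: nat_pow_mult[symmetric] nat_pow_pow[symmetric] m_comm kG)
        ultimately have "(y \<otimes> k [^] s) \<otimes> inv (k [^] s) \<in> L"
          using KL ak(2) by (auto intro!: subgroup.m_closed[OF L] subgroup.m_inv_closed[OF L]
              subgroup_nat_pow_closed[OF L])
        hence "y \<in> L" using yG kG by (simp add: m_assoc)
        thus ?thesis using yL by simp
      qed
    qed
    moreover have "K' \<subseteq> H"
      using K(2) by (auto simp: K'eq intro!: subgroup.m_closed[OF H] subgroup_nat_pow_closed[OF H] yH)
    ultimately have "K' \<in> \<K>" using K' by (simp add: \<K>_def)
    moreover have "K \<subseteq> K'"
    proof
      fix k assume "k \<in> K"
      thus "k \<in> K'" using KG by (auto simp: K'eq intro!: exI[of _ "0::nat"] exI[of _ k])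
    qed
    ultimately have "K = K'" by (rule Kmax)
    moreover have "y \<in> K'"
      using subgroup.one_closed[OF K(1)] yG
      by (auto simp: K'eq intro!: exI[of _ "1::nat"] exI[of _ \<one>])
    ultimately show False using yL KL by blast
  qed
  ultimately show ?thesis using that K Leq by blast
qed

text \<open>
  The structural half of Olson's theorem: an upper bound for the length of nonvanishing products in
  the group ring is attained by a zero-sum free sequence.
\<close>

lemma ex_zero_sum_free_annihilation_bound:
  assumes p: "prime p" "odd p" and fin: "finite (carrier G)" and ord: "order G = p ^ N"
    and H: "subgroup H G"
  shows "\<exists>d M. annihilation_bound p H (Suc d) \<and> set_mset M \<subseteq> H \<and> size M = d \<and>
           (\<forall>T. T \<subseteq># M \<longrightarrow> seq_sum G T = \<one> \<longrightarrow> T = {#})"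
  using H
proof (induction "card H" arbitrary: H rule: less_induct)
  case less
  note H = less.prems
  have HG: "H \<subseteq> carrier G" using H by (rule subgroup.subset)
  hence finH: "finite H" using fin finite_subset by blast
  show ?case
  proof (cases "H = {\<one>}")
    case True
    have "annihilating p M" if M: "set_mset M \<subseteq> {\<one>}" "1 \<le> size M" for M
    proof -
      obtain x M' where "M = add_mset x M'" using M(2) by (cases M) auto
      thus ?thesis using M(1) annihilating_one by auto
    qed
    thus ?thesis using True
      by (intro exI[of _ 0] exI[of _ "{#}"]) (auto simp: annihilation_bound_def)
  next
    case False
    have "H \<noteq> {}" using subgroup.one_closed[OF H] by blast
    \<comment> \<open>All orders are powers of \<open>p\<close>, so the largest one is a multiple of
      every other.\<close>
    define r where "r = Max (ord ` H)"
    have "r \<in> ord ` H" unfolding r_def using finH \<open>H \<noteq> {}\<close> by (intro Max_in) auto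
    then obtain g where g: "g \<in> H" and r: "r = ord g" by blast
    have gmax: "ord x \<le> ord g" if "x \<in> H" for x
      unfolding r[symmetric] r_def using finH that by (intro Max_ge) auto
    have gG: "g \<in> carrier G" using g HG by blast
    have pow: "\<exists>i. ord x = p ^ i" if "x \<in> H" for x
    proof -
      have "ord x dvd p ^ N" using ord_dvd_group_order[of x] ord that HG by auto
      thus ?thesis using divides_primepow_nat[OF p(1)] by blast
    qed
    obtain m where m: "ord g = p ^ m" using pow[OF g] by blast
    have max: "x [^] ord g = \<one>" if x: "x \<in> H" for x
    proof -
      obtain i where i: "ord x = p ^ i" using pow[OF x] by blast
      have "p ^ i \<le> p ^ m" using gmax[OF x] unfolding i m .
      hence "i \<le> m" using prime_gt_1_nat[OF p(1)] power_le_imp_le_exp by blast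
      hence "ord x dvd ord g" using i m by (simp add: le_imp_power_dvd)
      thus ?thesis using pow_eq_id x HG by blast
    qed
    obtain K where K: "subgroup K G" "K \<subseteq> H" "\<And>a::nat. g [^] a \<in> K \<Longrightarrow> g [^] a = \<one>"
        "H = {g [^] a \<otimes> k | (a::nat) k. k \<in> K}"
      using cyclic_complement[OF p(1) fin ord H g max] by blast
    have "K \<noteq> H"
    proof
      assume "K = H"
      hence "g = \<one>" using K(3)[of 1] g gG by simp
      hence "x = \<one>" if "x \<in> H" for x using max[OF that] that HG by auto
      thus False using False \<open>H \<noteq> {}\<close> by blast
    qed
    hence "card K < card H" using K(2) finH by (meson psubsetI psubset_card_mono)
    from less.hyps[OF this K(1)] obtain d M where dM: "annihilation_bound p K (Suc d)"
      "set_mset M \<subseteq> K" "size M = d" "\<And>T. T \<subseteq># M \<Longrightarrow> seq_sum G T = \<one> \<Longrightarrow> T = {#}"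
      by blast
    have KG: "K \<subseteq> carrier G" using K(2) HG by blast
    \<comment> \<open>Appending \<open>ord g - 1\<close> copies of \<open>g\<close> lengthens the
      zero-sum free sequence by exactly as much as the annihilation bound grows.\<close>
    define R where "R = replicate_mset (ord g - 1) g"
    have "annihilation_bound p H (Suc d + (ord g - 1))"
      unfolding K(4) using dM(1) gG KG subgroup.one_closed[OF K(1)]
      by (intro annihilation_bound_cyclic_mult[OF p m]) auto
    moreover have "set_mset (R + M) \<subseteq> H" using dM(2) K(2) g by (auto simp: R_def)
    moreover have "size (R + M) = d + (ord g - 1)" using dM(3) by (simp add: R_def)
    moreover have "T = {#}" if T: "T \<subseteq># R + M" "seq_sum G T = \<one>" for T
    proof -
      \<comment> \<open>\<open>T1\<close> sums to a power of \<open>g\<close> and \<open>T2\<close>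
        to an element of \<open>K\<close>. These are inverse to each other, so both are trivial by
        independence.\<close>
      define T1 T2 where "T1 = T \<inter># R" and "T2 = T - R"
      have T12: "T = T1 + T2" by (auto simp: T1_def T2_def multiset_eq_iff min_def)
      have T2: "T2 \<subseteq># M" using T(1) by (simp add: T2_def subset_eq_diff_conv add.commute)
      have "T1 \<subseteq># R" by (simp add: T1_def)
      then obtain a where a: "a \<le> ord g - 1" "T1 = replicate_mset a g"
        unfolding R_def by (rule msubseteq_replicate_msetE)
      have T2K: "set_mset T2 \<subseteq> K" using T2 dM(2) set_mset_mono by blast
      have s2: "seq_sum G T2 \<in> K" by (rule seq_sum_mem_subgroup[OF K(1) T2K])
      have eq: "g [^] a \<otimes> seq_sum G T2 = \<one>"
        using T(2) T12 a(2) gG T2K KG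
        by (simp add: seq_sum_union seq_sum_replicate_mset order_trans)
      hence "g [^] a = inv (seq_sum G T2)"
        using gG s2 KG by (metis inv_equality nat_pow_closed subsetD)
      hence "g [^] a = \<one>" using K(3)[of a] subgroup.m_inv_closed[OF K(1) s2] by metis
      moreover from this have "ord g dvd a" using pow_eq_id gG by simp
      hence "a = 0" using a(1) ord_ge_1[OF fin gG] by (auto dest: dvd_imp_le)
      moreover have "seq_sum G T2 = \<one>" using eq \<open>g [^] a = \<one>\<close> s2 KG by auto
      hence "T2 = {#}" using dM(4) T2 by blast
      ultimately show ?thesis using T12 a(2) by simp
    qed
    ultimately show ?thesis
      by (intro exI[of _ "d + (ord g - 1)"] exI[of _ "R + M"]) auto
  qed
qed

section \<open>Olson's theorem on the Davenport constant\<close>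

lemma davenport_constant_witness:
  assumes "N > 0" and "\<And>S. sequence_over G S \<Longrightarrow> N \<le> size S \<Longrightarrow>
        \<exists>T. T \<subseteq># S \<and> T \<noteq> {#} \<and> seq_sum G T = \<one>"
  shows "davenport_constant G > 0"
    and "\<And>S. sequence_over G S \<Longrightarrow> davenport_constant G \<le> size S \<Longrightarrow>
        \<exists>T. T \<subseteq># S \<and> T \<noteq> {#} \<and> seq_sum G T = \<one>"
proof -
  let ?P = "\<lambda>N. N > 0 \<and> (\<forall>S. sequence_over G S \<and> size S \<ge> N \<longrightarrow>
        (\<exists>T. T \<subseteq># S \<and> T \<noteq> {#} \<and> seq_sum G T = \<one>))"
  have "?P (davenport_constant G)"
    unfolding davenport_constant_def by (rule LeastI[of ?P N]) (use assms in blast)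
  thus "davenport_constant G > 0"
    and "\<And>S. sequence_over G S \<Longrightarrow> davenport_constant G \<le> size S \<Longrightarrow>
        \<exists>T. T \<subseteq># S \<and> T \<noteq> {#} \<and> seq_sum G T = \<one>"
    by blast+
qed

text \<open>The vanishing product is applied to the indicator function of the identity and evaluated
  at \<open>c\<close>, which reads off a single coefficient.\<close>

lemma signed_count_dvd:
  assumes "finite I" "g \<in> I \<rightarrow> carrier G" "c \<in> carrier G"
    and "annihilation_bound p (carrier G) d" "d \<le> card I"
  shows "int p dvd (\<Sum>J\<in>Pow I. (-1) ^ card J * (if finprod G g J \<otimes> c = \<one> then 1 else 0))"
proof -
  have "annihilating p (image_mset g (mset_set I))"
    using assms by (intro assms(4)[unfolded annihilation_bound_def, rule_format]) auto
  hence "int p dvd diffs (image_mset g (mset_set I)) (\<lambda>y. if y = \<one> then 1 else 0) c"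
    using assms(3) unfolding annihilating_def by blast
  thus ?thesis by (simp only: diffs_image_mset[OF assms(1-3)])
qed

text \<open>The bound \<open>Suc d\<close> forces nonempty zero-sum subsequences, so the
  \<open>LEAST\<close> is attained. The zero-sum free \<open>M\<close> of length \<open>d\<close>
  shows that it is at least \<open>Suc d\<close>, and the bound carries over.\<close>

lemma annihilation_bound_davenport_constant:
  assumes p: "prime p" "odd p" and fin: "finite (carrier G)" and ord: "order G = p ^ N"
  shows "davenport_constant G > 0" "annihilation_bound p (carrier G) (davenport_constant G)"
proof -
  obtain d M where dM: "annihilation_bound p (carrier G) (Suc d)" "set_mset M \<subseteq> carrier G"
    "size M = d" "\<And>T. T \<subseteq># M \<Longrightarrow> seq_sum G T = \<one> \<Longrightarrow> T = {#}"
    using ex_zero_sum_free_annihilation_bound[OF p fin ord subgroup_self] by blast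
  have ex: "\<exists>T. T \<subseteq># S \<and> T \<noteq> {#} \<and> seq_sum G T = \<one>"
    if S: "sequence_over G S" "Suc d \<le> size S" for S
  proof (rule ccontr)
    assume free: "\<nexists>T. T \<subseteq># S \<and> T \<noteq> {#} \<and> seq_sum G T = \<one>"
    obtain xs where xs: "mset xs = S" using ex_mset by blast
    define I where "I = {..<length xs}"
    have I: "finite I" "(!) xs \<in> I \<rightarrow> carrier G" "image_mset ((!) xs) (mset_set I) = S" "card I = size S"
      using S(1) xs by (auto simp: I_def sequence_over_def mset_map[symmetric] lessThan_atLeast0
          map_nth simp flip: mset_upt)
    \<comment> \<open>In a zero-sum free sequence only the empty index set contributes, so the
      signed count is 1, contrary to divisibility by \<open>p\<close>.\<close>
    have "(\<Sum>J\<in>Pow I. (-1) ^ card J * (if finprod G ((!) xs) J \<otimes> \<one> = \<one> then 1 else 0))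
       = (\<Sum>J\<in>Pow I. if J = {} then 1 else (0::int))"
    proof (rule sum.cong)
      fix J assume J: "J \<in> Pow I"
      hence J': "finite J" "(!) xs \<in> J \<rightarrow> carrier G" using I by (auto intro: finite_subset)
      have "image_mset ((!) xs) (mset_set J) \<subseteq># S"
        unfolding I(3)[symmetric] using J I(1)
        by (intro image_mset_subseteq_mono) (simp add: subset_imp_msubset_mset_set)
      hence "finprod G ((!) xs) J \<noteq> \<one>" if "J \<noteq> {}"
        using free that J' seq_sum_image_mset[OF J'] by (auto simp: mset_set_empty_iff)
      thus "(-1) ^ card J * (if finprod G ((!) xs) J \<otimes> \<one> = \<one> then 1 else 0)
         = (if J = {} then 1 else (0::int))"
        using J' by (auto simp: finprod_closed)
    qed simp
    also have "\<dots> = 1" using I(1) by simp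
    finally show False
      using signed_count_dvd[OF I(1,2) one_closed dM(1)] S(2) I(4) prime_gt_1_nat[OF p(1)]
      by simp
  qed
  note D = davenport_constant_witness[of "Suc d", OF _ ex]
  show "davenport_constant G > 0" using D(1) by blast
  have "\<not> davenport_constant G \<le> size M"
    using D(2)[of M] dM(2,4) by (auto simp: sequence_over_def)
  thus "annihilation_bound p (carrier G) (davenport_constant G)"
    using dM(1,3) by (simp add: annihilation_bound_def)
qed


section \<open>Counting zero-sum subfamilies\<close>

text \<open>Index sets replace sub-multisets so that equal terms are counted separately.\<close>

definition zero_sum_sets :: "('i \<Rightarrow> 'a) \<Rightarrow> 'i set \<Rightarrow> 'i set set" where
  "zero_sum_sets g I = {J. J \<subseteq> I \<and> finprod G g J = \<one>}"

lemma finite_zero_sum_sets: "finite I \<Longrightarrow> finite (zero_sum_sets g I)"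
  by (rule finite_subset[of _ "Pow I"]) (auto simp: zero_sum_sets_def)

text \<open>Double count pairs of a zero-sum \<open>J\<close> and a \<open>j\<close>-subset
  \<open>K\<close> of it. For fixed \<open>K\<close> the sets \<open>J - K\<close> range over
  subsets of \<open>I - K\<close>, which still has at least \<open>d\<close> elements, so the signed
  count with \<open>c\<close> the product over \<open>K\<close> applies.\<close>

lemma signed_count_choose_dvd:
  assumes I: "finite I" and g: "g \<in> I \<rightarrow> carrier G"
    and ann: "annihilation_bound p (carrier G) d" and card: "d + j \<le> card I"
  shows "int p dvd (\<Sum>J\<in>zero_sum_sets g I. (-1) ^ card J * int (card J choose j))"
proof -
  let ?S = "{K. K \<subseteq> I \<and> card K = j}"
  let ?z = "\<lambda>J. if finprod G g J = \<one> then (-1) ^ card J else (0::int)"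
  have "(\<Sum>J\<in>zero_sum_sets g I. (-1) ^ card J * int (card J choose j))
      = (\<Sum>J\<in>Pow I. ?z J * int (card J choose j))"
    using I by (intro sum.mono_neutral_cong_left) (auto simp: zero_sum_sets_def)
  also have "\<dots> = (\<Sum>J\<in>Pow I. \<Sum>K\<in>?S. if K \<subseteq> J then ?z J else 0)"
  proof (rule sum.cong)
    fix J assume J: "J \<in> Pow I"
    hence "finite J" using I finite_subset by blast
    hence "int (card J choose j) = (\<Sum>K\<in>{K. K \<subseteq> J \<and> card K = j}. 1)"
      by (simp add: n_subsets)
    also have "\<dots> = (\<Sum>K\<in>?S. if K \<subseteq> J then 1 else 0)"
      using I J by (intro sum.mono_neutral_cong_left) auto
    finally show "?z J * int (card J choose j) = (\<Sum>K\<in>?S. if K \<subseteq> J then ?z J else 0)"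
      by (simp add: sum_distrib_left if_distrib cong: if_cong)
  qed simp
  also have "\<dots> = (\<Sum>K\<in>?S. \<Sum>J\<in>Pow I. if K \<subseteq> J then ?z J else 0)"
    by (rule sum.swap)
  also have "\<dots> = (\<Sum>K\<in>?S. (-1) ^ j * (\<Sum>J\<in>Pow (I - K).
        (-1) ^ card J * (if finprod G g J \<otimes> finprod G g K = \<one> then 1 else 0)))"
  proof (rule sum.cong)
    fix K assume K: "K \<in> ?S"
    have finK: "finite K" using K I finite_subset by blast
    have "(\<Sum>J\<in>Pow I. if K \<subseteq> J then ?z J else 0) = (\<Sum>J\<in>{J\<in>Pow I. K \<subseteq> J}. ?z J)"
      using I by (simp add: sum.inter_filter[symmetric])
    also have "\<dots> = (\<Sum>J\<in>Pow (I - K). ?z (J \<union> K))"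
      using K by (intro sum.reindex_bij_witness[of _ "\<lambda>J. J \<union> K" "\<lambda>J. J - K"])
        (auto simp: Un_absorb1 Un_absorb2 Diff_triv)
    also have "\<dots> = (\<Sum>J\<in>Pow (I - K). (-1) ^ j * ((-1) ^ card J *
        (if finprod G g J \<otimes> finprod G g K = \<one> then 1 else 0)))"
    proof (rule sum.cong)
      fix J assume J: "J \<in> Pow (I - K)"
      hence fin: "finite J" "J \<inter> K = {}" using I finite_subset by blast+
      have "finprod G g (J \<union> K) = finprod G g J \<otimes> finprod G g K"
        using fin finK g J K by (intro finprod_Un_disjoint) auto
      moreover have "card (J \<union> K) = card J + j" using fin finK K by (simp add: card_Un_disjoint)
      ultimately show "?z (J \<union> K) = (-1) ^ j * ((-1) ^ card J *
        (if finprod G g J \<otimes> finprod G g K = \<one> then 1 else 0))"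
        by (simp add: power_add)
    qed simp
    finally show "(\<Sum>J\<in>Pow I. if K \<subseteq> J then ?z J else 0) = (-1) ^ j * (\<Sum>J\<in>Pow (I - K).
        (-1) ^ card J * (if finprod G g J \<otimes> finprod G g K = \<one> then 1 else 0))"
      by (simp add: sum_distrib_left)
  qed simp
  also have "int p dvd \<dots>"
  proof (rule dvd_sum, rule dvd_mult)
    fix K assume K: "K \<in> ?S"
    have finK: "finite K" using K I finite_subset by blast
    have "d \<le> card (I - K)" using K card finK by (simp add: card_Diff_subset)
    thus "int p dvd (\<Sum>J\<in>Pow (I - K).
        (-1) ^ card J * (if finprod G g J \<otimes> finprod G g K = \<one> then 1 else 0))"
      using I g K by (intro signed_count_dvd[OF _ _ _ ann] finprod_closed) auto
  qed
  finally show ?thesis .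
qed

text \<open>Vandermonde expands the shifted weight into the weights \<open>card J choose i\<close>
  with \<open>i \<le> j\<close>.\<close>

lemma signed_count_shifted_choose_dvd:
  assumes "finite I" "g \<in> I \<rightarrow> carrier G" "annihilation_bound p (carrier G) d" "d + j \<le> card I"
  shows "int p dvd (\<Sum>J\<in>zero_sum_sets g I. (-1) ^ card J * int ((card J + s) choose j))"
proof -
  have "(\<Sum>J\<in>zero_sum_sets g I. (-1) ^ card J * int ((card J + s) choose j))
    = (\<Sum>J\<in>zero_sum_sets g I. \<Sum>i\<le>j. (-1) ^ card J * (int (card J choose i) * int (s choose (j - i))))"
    by (simp only: vandermonde[symmetric] of_nat_sum of_nat_mult sum_distrib_left)
  also have "\<dots> = (\<Sum>i\<le>j. int (s choose (j - i)) *
      (\<Sum>J\<in>zero_sum_sets g I. (-1) ^ card J * int (card J choose i)))"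
    by (subst sum.swap) (simp add: sum_distrib_left mult_ac)
  also have "int p dvd \<dots>"
    using assms by (intro dvd_sum dvd_mult signed_count_choose_dvd) auto
  finally show ?thesis .
qed

text \<open>The case \<open>j = n - 1\<close> of the shifted count, where the weight is an indicator
  modulo \<open>p\<close>. The shift selects the class: \<open>s = n - 1\<close> gives lengths
  divisible by \<open>n\<close>, \<open>s = q - 1\<close> lengths congruent to
  \<open>- q\<close>.\<close>

lemma signed_count_residue_dvd:
  assumes p: "prime p" "n = p ^ m"
    and I: "finite I" "g \<in> I \<rightarrow> carrier G" "annihilation_bound p (carrier G) d" "d + (n - 1) \<le> card I"
  shows "int p dvd (\<Sum>J\<in>zero_sum_sets g I. if n dvd card J + Suc s then (-1) ^ card J else 0)"
proof -
  have "[(\<Sum>J\<in>zero_sum_sets g I. (-1) ^ card J * int ((card J + s) choose (n - 1)))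
      = (\<Sum>J\<in>zero_sum_sets g I. if n dvd card J + Suc s then (-1) ^ card J else 0)] (mod int p)"
  proof (rule cong_sum)
    fix J
    have "[int ((card J + s) choose (n - 1)) = (if n dvd card J + Suc s then 1 else 0)] (mod int p)"
      using choose_prime_power_minus_1_cong[OF p, of "card J + s"]
      by (simp flip: cong_int_iff split: if_splits)
    hence "[(-1) ^ card J * int ((card J + s) choose (n - 1))
      = (-1) ^ card J * (if n dvd card J + Suc s then 1 else 0)] (mod int p)"
      by (rule cong_scalar_left)
    thus "[(-1) ^ card J * int ((card J + s) choose (n - 1))
      = (if n dvd card J + Suc s then (-1) ^ card J else 0)] (mod int p)"
      by (simp split: if_splits)
  qed
  thus ?thesis
    using signed_count_shifted_choose_dvd[OF I] cong_dvd_iff by blast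
qed

lemma finprod_Diff_one:
  assumes "finite J" "g \<in> J \<rightarrow> carrier G" "C \<subseteq> J" "finprod G g J = \<one>" "finprod G g C = \<one>"
  shows "finprod G g (J - C) = \<one>"
proof -
  have "finite C" using assms finite_subset by blast
  hence "finprod G g ((J - C) \<union> C) = finprod G g (J - C) \<otimes> finprod G g C"
    using assms by (intro finprod_Un_disjoint) auto
  moreover have "(J - C) \<union> C = J" using assms(3) by blast
  moreover have "finprod G g (J - C) \<in> carrier G" using assms(2) by (intro finprod_closed) auto
  ultimately show ?thesis using assms by simp
qed

definition zero_sum_count :: "('i \<Rightarrow> 'a) \<Rightarrow> nat \<Rightarrow> 'i set \<Rightarrow> nat" where
  "zero_sum_count g r I = card {J \<in> zero_sum_sets g I. card J = r}"

lemma sum_zero_sum_sets_card: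
  assumes "finite I"
  shows "(\<Sum>J\<in>zero_sum_sets g I. if card J = r then c else 0) = c * int (zero_sum_count g r I)"
  using finite_zero_sum_sets[OF assms, of g]
  by (simp add: zero_sum_count_def sum.inter_filter[symmetric])

text \<open>Count pairs of disjoint zero-sum families \<open>(A, C)\<close> by \<open>A\<close>, and by \<open>A \<union> C\<close>.\<close>

lemma zero_sum_pairs_count:
  assumes I: "finite I" "g \<in> I \<rightarrow> carrier G"
  shows "(\<Sum>A\<in>{A \<in> zero_sum_sets g I. card A = r}. zero_sum_count g s (I - A))
       = (\<Sum>B\<in>{B \<in> zero_sum_sets g I. card B = r + s}. zero_sum_count g s B)"
proof -
  let ?Z = "\<lambda>r I. {J \<in> zero_sum_sets g I. card J = r}"
  have fin: "finite (?Z r J)" if "J \<subseteq> I" for r J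
    using finite_zero_sum_sets[of J g] finite_subset[OF that I(1)] by simp
  have "bij_betw (\<lambda>(A, C). (A \<union> C, C)) (SIGMA A:?Z r I. ?Z s (I - A)) (SIGMA B:?Z (r + s) I. ?Z s B)"
  proof (rule bij_betw_byWitness[where f' = "\<lambda>(B, C). (B - C, C)"])
    show "(\<lambda>(A, C). (A \<union> C, C)) ` (SIGMA A:?Z r I. ?Z s (I - A)) \<subseteq> (SIGMA B:?Z (r + s) I. ?Z s B)"
    proof (clarsimp simp: zero_sum_sets_def)
      fix A C assume *: "A \<subseteq> I" "finprod G g A = \<one>" "C \<subseteq> I - A" "finprod G g C = \<one>"
      hence "finite A" "finite C" "A \<inter> C = {}" using I(1) by (auto intro: finite_subset)
      moreover have "g \<in> A \<rightarrow> carrier G" "g \<in> C \<rightarrow> carrier G" using I(2) * by auto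
      ultimately show "C \<subseteq> I \<and> finprod G g (A \<union> C) = \<one> \<and> card (A \<union> C) = card A + card C"
        using * by (auto simp: finprod_Un_disjoint card_Un_disjoint)
    qed
    show "(\<lambda>(B, C). (B - C, C)) ` (SIGMA B:?Z (r + s) I. ?Z s B) \<subseteq> (SIGMA A:?Z r I. ?Z s (I - A))"
    proof (clarsimp simp: zero_sum_sets_def)
      fix B C assume *: "B \<subseteq> I" "finprod G g B = \<one>" "C \<subseteq> B" "finprod G g C = \<one>"
        "card B = r + card C"
      hence "finite B" using I(1) finite_subset by blast
      moreover have "finite C" using * \<open>finite B\<close> finite_subset by blast
      moreover have "g \<in> B \<rightarrow> carrier G" using I(2) * by auto
      ultimately show "B - C \<subseteq> I \<and> finprod G g (B - C) = \<one> \<and> card (B - C) = r \<and> C \<subseteq> I - (B - C)"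
        using * by (auto simp: finprod_Diff_one card_Diff_subset)
    qed
  qed (auto simp: zero_sum_sets_def)
  hence "card (SIGMA A:?Z r I. ?Z s (I - A)) = card (SIGMA B:?Z (r + s) I. ?Z s B)"
    by (rule bij_betw_same_card)
  moreover have "card (SIGMA A:?Z r I. ?Z s (I - A)) = (\<Sum>A\<in>?Z r I. card (?Z s (I - A)))"
    using fin by (intro card_SigmaI) (auto simp: zero_sum_sets_def)
  moreover have "card (SIGMA B:?Z (r + s) I. ?Z s B) = (\<Sum>B\<in>?Z (r + s) I. card (?Z s B))"
    using fin by (intro card_SigmaI) (auto simp: zero_sum_sets_def)
  ultimately show ?thesis by (simp only: zero_sum_count_def)
qed

text \<open>The counting argument for an arbitrary annihilation bound \<open>d\<close> in the role
  of D(G); the length is fixed by an equation free of truncated subtraction.\<close>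

lemma ex_zero_sum_subfamily:
  assumes p: "prime p" "odd p" and n: "n = p ^ m" and q: "q = p ^ k" and qn: "q \<le> n"
    and ann: "annihilation_bound p (carrier G) d" and d: "d > 0" "d + q \<le> 2 * n"
    and I: "finite I" "g \<in> I \<rightarrow> carrier G" and card: "card I + q + 1 = d + 2 * n"
  shows "\<exists>J\<in>zero_sum_sets g I. card J = n"
proof (rule ccontr)
  assume no: "\<not> (\<exists>J\<in>zero_sum_sets g I. card J = n)"
  have n0: "n > 0" "odd n" and q0: "q > 0" "odd q" using p n q prime_gt_0_nat by auto
  have sub: "finite A" "g \<in> A \<rightarrow> carrier G" if "A \<subseteq> I" for A
    using that I finite_subset by auto
  have mono: "J \<in> zero_sum_sets g I" if "J \<in> zero_sum_sets g A" "A \<subseteq> I" for J A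
    using that by (auto simp: zero_sum_sets_def)
  have small: "card A < 4 * n" if "A \<subseteq> I" for A
    using card_mono[OF I(1) that] card d(2) q0 by linarith
  \<comment> \<open>Delete one index from \<open>J\<close>. The remaining
    \<open>3 * n - 1 \<ge> d + (n - 1)\<close> indices contain a nonempty zero-sum set of size
    \<open>n\<close> or \<open>2 * n\<close>; in the latter case its complement in \<open>J\<close>
    has size \<open>n\<close>.\<close>
  have no3: "card J \<noteq> 3 * n" if J: "J \<in> zero_sum_sets g I" for J
  proof
    assume c3: "card J = 3 * n"
    have JI: "J \<subseteq> I" using J by (simp add: zero_sum_sets_def)
    obtain x where x: "x \<in> J" using c3 n0 by fastforce
    define A where "A = J - {x}"
    have AI: "A \<subseteq> I" using JI by (auto simp: A_def)
    have cA: "card A = 3 * n - 1" using x c3 by (simp add: A_def sub(1)[OF JI])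
    have "\<exists>C\<in>zero_sum_sets g A. n dvd card C \<and> C \<noteq> {}"
    proof (rule ccontr)
      assume none: "\<not> ?thesis"
      have "(\<Sum>C\<in>zero_sum_sets g A. if n dvd card C + Suc (n - 1) then (-1) ^ card C else 0)
          = (\<Sum>C\<in>zero_sum_sets g A. if C = {} then 1 else (0::int))"
        using none n0 by (intro sum.cong) auto
      also have "\<dots> = 1" using finite_zero_sum_sets[OF sub(1)[OF AI], of g]
        by (simp add: zero_sum_sets_def)
      moreover have "d + (n - 1) \<le> card A" using cA d n0 q0 by linarith
      ultimately have "int p dvd 1"
        using signed_count_residue_dvd[OF p(1) n sub[OF AI] ann, of "n - 1"] by simp
      thus False using prime_gt_1_nat[OF p(1)] by simp
    qed
    then obtain C where C: "C \<in> zero_sum_sets g A" "n dvd card C" "C \<noteq> {}" by blast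
    have CJ: "C \<subseteq> J" and CA: "C \<subseteq> A" using C(1) by (auto simp: zero_sum_sets_def A_def)
    have "card C \<le> 3 * n - 1" using card_mono[OF sub(1)[OF AI] CA] cA by simp
    moreover have "card C > 0" using C(3) CA sub(1)[OF AI] finite_subset by (simp add: card_gt_0_iff)
    moreover obtain u where u: "card C = n * u" using C(2) by blast
    ultimately have "0 < n * u" "n * u < n * 3" using n0 by linarith+
    hence "u = 1 \<or> u = 2" using n0 by auto
    thus False
    proof
      assume "u = 1"
      thus False using no mono[OF C(1) AI] u by auto
    next
      assume "u = 2"
      hence "card (J - C) = n"
        using u c3 CJ sub(1)[OF JI] by (simp add: card_Diff_subset finite_subset)
      moreover have "J - C \<in> zero_sum_sets g I"
        using finprod_Diff_one[OF sub[OF JI] CJ] C(1) J by (auto simp: zero_sum_sets_def)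
      ultimately show False using no by blast
    qed
  qed
  have lengths: "card J = 0 \<or> card J = 2 * n" if J: "J \<in> zero_sum_sets g I" "n dvd card J" for J
  proof -
    obtain u where u: "card J = n * u" using J(2) by blast
    have "n * u < n * 4" using small[of J] J(1) u by (simp add: zero_sum_sets_def)
    hence "u = 0 \<or> u = 1 \<or> u = 2 \<or> u = 3" by auto
    thus ?thesis using no no3[OF J(1)] J(1) u by auto
  qed
  \<comment> \<open>Among sizes divisible by \<open>n\<close> only 0 and \<open>2 * n\<close> occur,
    both even, and the empty set contributes 1. General \<open>A\<close> is required for the double
    counting below.\<close>
  have e1: "[int (zero_sum_count g (2 * n) A) = - 1] (mod int p)"
    if A: "A \<subseteq> I" "d + (n - 1) \<le> card A" for A
  proof -
    have "(\<Sum>J\<in>zero_sum_sets g A. if n dvd card J + Suc (n - 1) then (-1) ^ card J else 0)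
        = (\<Sum>J\<in>zero_sum_sets g A. (if card J = 0 then 1 else 0) + (if card J = 2 * n then 1 else (0::int)))"
      using lengths mono[OF _ A(1)] n0 by (intro sum.cong) fastforce+
    also have "\<dots> = int (zero_sum_count g 0 A) + int (zero_sum_count g (2 * n) A)"
      by (simp add: sum.distrib sum_zero_sum_sets_card[OF sub(1)[OF A(1)]])
    also have "zero_sum_count g 0 A = 1"
    proof -
      have "{J \<in> zero_sum_sets g A. card J = 0} = {{}}"
        using sub(1)[OF A(1)] by (auto simp: zero_sum_sets_def finite_subset)
      thus ?thesis by (simp add: zero_sum_count_def)
    qed
    finally show ?thesis
      using signed_count_residue_dvd[OF p(1) n sub[OF A(1)] ann A(2), of "n - 1"]
      by (simp add: cong_iff_dvd_diff add.commute)
  qed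
  show False
  proof (cases "q = n")
    \<comment> \<open>Here \<open>card I = d + n - 1 < 2 * n\<close>, so no set of size
      \<open>2 * n\<close> exists, against \<open>e1\<close>.\<close>
    case True
    have "card J \<noteq> 2 * n" if "J \<in> zero_sum_sets g I" for J
    proof -
      have "card J \<le> card I" using that I(1) by (simp add: zero_sum_sets_def card_mono)
      thus ?thesis using card d True n0 by linarith
    qed
    hence "{J \<in> zero_sum_sets g I. card J = 2 * n} = {}" by blast
    hence "zero_sum_count g (2 * n) I = 0" by (simp only: zero_sum_count_def card.empty)
    moreover have "d + (n - 1) \<le> card I" using card True n0 by linarith
    ultimately have "[0 = - 1] (mod int p)" using e1[of I] by simp
    thus False using prime_gt_1_nat[OF p(1)] by (simp add: cong_iff_dvd_diff)
  next
    case False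
    hence qn: "q < n" using qn by simp
    define a b c e where "a = int (zero_sum_count g (n - q) I)"
      and "b = int (zero_sum_count g (2 * n - q) I)"
      and "c = int (zero_sum_count g (3 * n - q) I)" and "e = int (zero_sum_count g (2 * n) I)"
    have par: "even (n - q)" "odd (2 * n - q)" "even (3 * n - q)" using n0 q0 qn by auto
    have lengths': "card J = n - q \<or> card J = 2 * n - q \<or> card J = 3 * n - q"
      if J: "J \<in> zero_sum_sets g I" "n dvd card J + q" for J
    proof -
      obtain u where u: "card J + q = n * u" using J(2) by blast
      have "card J \<le> card I" using J(1) I(1) by (auto simp: zero_sum_sets_def intro: card_mono)
      hence "n * u < n * 4" using u card d q0 by linarith
      moreover have "u \<noteq> 0" using u q0 by (cases u) auto
      ultimately have "u = 1 \<or> u = 2 \<or> u = 3" by auto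
      thus ?thesis using u by auto
    qed
    have E1: "[e = - 1] (mod int p)"
      unfolding e_def using card qn by (intro e1) auto
    have E2: "[a - b + c = 0] (mod int p)"
    proof -
      have "(\<Sum>J\<in>zero_sum_sets g I. if n dvd card J + Suc (q - 1) then (-1) ^ card J else 0)
        = (\<Sum>J\<in>zero_sum_sets g I. (if card J = n - q then 1 else 0)
            + (if card J = 2 * n - q then - 1 else 0) + (if card J = 3 * n - q then 1 else (0::int)))"
      proof (intro sum.cong refl)
        fix J assume J: "J \<in> zero_sum_sets g I"
        have dvd: "n dvd card J + q" if "card J = n - q \<or> card J = 2 * n - q \<or> card J = 3 * n - q"
          using that qn by auto
        show "(if n dvd card J + Suc (q - 1) then (-1) ^ card J else 0)
          = (if card J = n - q then 1 else 0)
            + (if card J = 2 * n - q then - 1 else 0) + (if card J = 3 * n - q then 1 else (0::int))"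
        proof (cases "n dvd card J + q")
          case True
          thus ?thesis using lengths'[OF J True] par qn q0 n0 by auto
        next
          case False
          thus ?thesis using dvd q0 by auto
        qed
      qed
      also have "\<dots> = a - b + c"
        by (simp add: sum.distrib sum_zero_sum_sets_card[OF I(1)] a_def b_def c_def)
      finally show ?thesis
        using signed_count_residue_dvd[OF p(1) n I ann, of "q - 1"] card qn by (simp add: cong_0_iff)
    qed
    \<comment> \<open>Both \<open>I - A\<close>, of size exactly \<open>d + (n - 1)\<close>, and
      \<open>B\<close>, of size \<open>3 * n - q\<close>, are large enough for \<open>e1\<close>, so
      every inner count is -1.\<close>
    have E3: "[a = c] (mod int p)"
    proof -
      let ?A = "{A \<in> zero_sum_sets g I. card A = n - q}"
      let ?B = "{B \<in> zero_sum_sets g I. card B = n - q + 2 * n}"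
      have "- a = (\<Sum>A\<in>?A. - 1)" by (simp add: a_def zero_sum_count_def)
      also have "[(\<Sum>A\<in>?A. - 1) = (\<Sum>A\<in>?A. int (zero_sum_count g (2 * n) (I - A)))] (mod int p)"
      proof (rule cong_sum)
        fix A assume A: "A \<in> ?A"
        hence AI: "A \<subseteq> I" by (simp add: zero_sum_sets_def)
        have "card (I - A) = card I - (n - q)" using A AI sub(1)[OF AI] by (simp add: card_Diff_subset)
        thus "[- 1 = int (zero_sum_count g (2 * n) (I - A))] (mod int p)"
          using card qn by (intro cong_sym[OF e1]) auto
      qed
      also have "(\<Sum>A\<in>?A. int (zero_sum_count g (2 * n) (I - A)))
          = (\<Sum>B\<in>?B. int (zero_sum_count g (2 * n) B))"
        unfolding of_nat_sum[symmetric] zero_sum_pairs_count[OF I] ..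
      also have "[(\<Sum>B\<in>?B. int (zero_sum_count g (2 * n) B)) = (\<Sum>B\<in>?B. - 1)] (mod int p)"
        using card qn d by (intro cong_sum e1) (auto simp: zero_sum_sets_def)
      also have "(\<Sum>B\<in>?B. - 1) = - c" using qn by (simp add: c_def zero_sum_count_def)
      finally show ?thesis by (simp add: cong_minus_minus_iff)
    qed
    \<comment> \<open>The weights are the quotients 1, 2, 3 for sizes \<open>n - q\<close>,
      \<open>2 * n - q\<close>, \<open>3 * n - q\<close> and -2 for \<open>2 * n\<close>, times the
      sign of the parity; the empty set has weight 0.\<close>
    have E4: "[a - 2 * b + 3 * c - 2 * e = 0] (mod int p)"
    proof -
      have "[(\<Sum>J\<in>zero_sum_sets g I. (-1) ^ card J * int ((card J + (n - 1)) choose (2 * n - q - 1)))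
        = (\<Sum>J\<in>zero_sum_sets g I. (if card J = n - q then 1 else 0)
            + (if card J = 2 * n - q then - 2 else 0) + (if card J = 3 * n - q then 3 else 0)
            + (if card J = 2 * n then - 2 else (0::int)))] (mod int p)"
      proof (rule cong_sum)
        fix J assume J: "J \<in> zero_sum_sets g I"
        let ?w = "if n dvd card J then - int (card J div n)
          else if n dvd card J + q then int ((card J + q) div n) else 0"
        have "\<not> n dvd u * n - q" if "0 < u" for u
        proof
          assume "n dvd u * n - q"
          moreover have "q \<le> u * n" using that qn by (cases u) auto
          ultimately have "n dvd q" using dvd_diffD1[of n "u * n" q] by simp
          thus False using nat_dvd_not_less[OF q0(1) qn] by blast
        qed
        from this[of 1] this[of 2] this[of 3]
        have nd: "\<not> n dvd n - q" "\<not> n dvd 2 * n - q" "\<not> n dvd 3 * n - q" by simp_all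
        have dvd: "n dvd card J + q" if "card J = n - q \<or> card J = 2 * n - q \<or> card J = 3 * n - q"
          using that qn by auto
        have "(-1) ^ card J * ?w = (if card J = n - q then 1 else 0)
            + (if card J = 2 * n - q then - 2 else 0) + (if card J = 3 * n - q then 3 else 0)
            + (if card J = 2 * n then - 2 else (0::int))"
        proof (cases "n dvd card J")
          case True
          thus ?thesis using lengths[OF J True] nd n0 by auto
        next
          case n1: False
          show ?thesis
          proof (cases "n dvd card J + q")
            case True
            thus ?thesis using lengths'[OF J True] par qn q0 n0 n1 by auto
          next
            case False
            thus ?thesis using dvd n1 by auto
          qed
        qed
        moreover have "[(-1) ^ card J * int ((card J + (n - 1)) choose (2 * n - q - 1))
          = (-1) ^ card J * ?w] (mod int p)"
          by (intro cong_scalar_left choose_two_residues_cong[OF p n q qn])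
        ultimately show "[(-1) ^ card J * int ((card J + (n - 1)) choose (2 * n - q - 1))
          = (if card J = n - q then 1 else 0)
            + (if card J = 2 * n - q then - 2 else 0) + (if card J = 3 * n - q then 3 else 0)
            + (if card J = 2 * n then - 2 else (0::int))] (mod int p)" by simp
      qed
      also have "(\<Sum>J\<in>zero_sum_sets g I. (if card J = n - q then 1 else 0)
            + (if card J = 2 * n - q then - 2 else 0) + (if card J = 3 * n - q then 3 else 0)
            + (if card J = 2 * n then - 2 else (0::int))) = a - 2 * b + 3 * c - 2 * e"
        by (simp add: sum.distrib sum_zero_sum_sets_card[OF I(1)] a_def b_def c_def e_def)
      finally show ?thesis
        using signed_count_shifted_choose_dvd[OF I ann, of "2 * n - q - 1" "n - 1"] card qn
        by (simp add: cong_0_iff cong_dvd_iff)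
    qed
    have dvds: "int p dvd e + 1" "int p dvd a - b + c" "int p dvd a - c"
        "int p dvd a - 2 * b + 3 * c - 2 * e"
      using E1 E2 E3 E4 by (simp_all add: cong_iff_dvd_diff)
    \<comment> \<open>In this combination all four unknowns cancel and 2 remains.\<close>
    have "int p dvd 2 * (e + 1) + (a - 2 * b + 3 * c - 2 * e) - 2 * (a - b + c) + (a - c)"
      by (rule dvd_add[OF dvd_diff[OF dvd_add[OF dvd_mult[OF dvds(1)] dvds(4)]
            dvd_mult[OF dvds(2)]] dvds(3)])
    hence "int p dvd 2" by simp
    hence "int p \<le> 2" by (rule zdvd_imp_le) simp
    hence "p = 2" using prime_gt_1_nat[OF p(1)] by simp
    thus False using p(2) by simp
  qed
qed

end

section \<open>From index sets to the Erdos-Ginzburg-Ziv constant\<close>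

theorem theorem2p1:
  fixes G :: "('a, 'b) monoid_scheme" and p k :: nat
  assumes "Factorial_Ring.prime p" and "p \<ge> 3"
    and "comm_group G" and "finite (carrier G)" and "\<exists>n. order G = p ^ n"
    and "p ^ k \<le> group_exponent G"
    and "int (davenport_constant G) \<le> 2 * int (group_exponent G) - int p ^ k"
  shows "int (egz_constant G) \<le> int (davenport_constant G) + 2 * int (group_exponent G) - int p ^ k - 1"
proof -
  interpret comm_group G by fact
  define n q d where "n = group_exponent G" and "q = p ^ k" and "d = davenport_constant G"
  obtain N where N: "order G = p ^ N" using assms(5) by blast
  have p: "prime p" "odd p" using assms(1,2) by (auto simp: prime_odd_nat)
  have d: "d > 0" "annihilation_bound p (carrier G) d"
    unfolding d_def using annihilation_bound_davenport_constant[OF p assms(4) N] by auto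
  \<comment> \<open>The remainder of \<open>p ^ N\<close> modulo the exponent also kills every
    element, so by minimality it is 0; hence \<open>n\<close> is a power of
    \<open>p\<close>.\<close>
  have "n dvd p ^ N"
  proof -
    let ?P = "\<lambda>n. n > 0 \<and> (\<forall>x\<in>carrier G. x [^]\<^bsub>G\<^esub> n = \<one>\<^bsub>G\<^esub>)"
    have PN: "?P (p ^ N)" using pow_order_eq_1 N prime_gt_0_nat[OF p(1)] by auto
    have n: "?P n" unfolding n_def group_exponent_def by (rule LeastI[of ?P, OF PN])
    have "x [^]\<^bsub>G\<^esub> (p ^ N mod n) = \<one>\<^bsub>G\<^esub>" if x: "x \<in> carrier G" for x
    proof -
      have "ord x dvd n" "ord x dvd p ^ N" using pow_eq_id[OF x] n PN x by auto
      thus ?thesis using pow_eq_id[OF x] by (simp add: dvd_mod)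
    qed
    moreover have "\<not> ?P (p ^ N mod n)"
      using n not_less_Least[of "p ^ N mod n" ?P] by (simp add: n_def group_exponent_def)
    ultimately show ?thesis by auto
  qed
  then obtain m where m: "n = p ^ m" using divides_primepow_nat[OF p(1)] by blast
  have qn: "q \<le> n" using assms(6) by (simp add: q_def n_def)
  have dq: "d + q \<le> 2 * n" using assms(7) unfolding d_def q_def n_def of_nat_power[symmetric] by linarith
  have "n > 0" using m prime_gt_0_nat[OF p(1)] by simp
  define l where "l = d + 2 * n - q - 1"
  have l: "l + q + 1 = d + 2 * n" "l > 0" using dq d(1) qn \<open>n > 0\<close> by (auto simp: l_def)
  have "egz_constant G \<le> l"
    unfolding egz_constant_def n_def[symmetric]
  proof (rule Least_le, intro conjI allI impI)
    fix S assume S: "sequence_over G S \<and> l \<le> size S"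
    \<comment> \<open>The counting needs length exactly \<open>l\<close>, so surplus terms are
      dropped and the rest indexed by list positions.\<close>
    obtain S' where S': "S' \<subseteq># S" "size S' = l" using S ex_submset_size by blast
    obtain xs where xs: "mset xs = S'" using ex_mset by blast
    define I where "I = {..<length xs}"
    have I: "finite I" "card I = l" "image_mset ((!) xs) (mset_set I) = S'"
      using xs S'(2) by (auto simp: I_def mset_map[symmetric] lessThan_atLeast0
          map_nth simp flip: mset_upt)
    have "set xs \<subseteq> carrier G"
      using S S'(1) xs set_mset_mono[OF S'(1)] by (auto simp: sequence_over_def)
    hence g: "(!) xs \<in> I \<rightarrow> carrier G" by (auto simp: I_def)
    have "card I + q + 1 = d + 2 * n" using l(1) I(2) by simp
    then obtain J where J: "J \<in> zero_sum_sets ((!) xs) I" "card J = n"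
      using ex_zero_sum_subfamily[OF p m q_def qn d(2,1) dq I(1) g] by blast
    hence JI: "J \<subseteq> I" by (simp add: zero_sum_sets_def)
    have finJ: "finite J" using JI I(1) finite_subset by blast
    let ?T = "image_mset ((!) xs) (mset_set J)"
    have "?T \<subseteq># S'"
      unfolding I(3)[symmetric] using JI I(1)
      by (intro image_mset_subseteq_mono) (simp add: subset_imp_msubset_mset_set)
    hence "?T \<subseteq># S" using S'(1) by (rule subset_mset.order_trans)
    moreover have "seq_sum G ?T = \<one>\<^bsub>G\<^esub>"
      using seq_sum_image_mset[OF finJ, of "(!) xs"] g JI J(1) by (auto simp: zero_sum_sets_def)
    moreover have "size ?T = n" using J(2) by simp
    ultimately show "\<exists>T. T \<subseteq># S \<and> seq_sum G T = \<one>\<^bsub>G\<^esub> \<and> size T = n" by blast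
  qed (use l in simp)
  hence "int (egz_constant G) \<le> int l" by simp
  also have "int l = int d + 2 * int n - int q - 1" using l(1) by linarith
  finally show ?thesis by (simp add: d_def n_def q_def)
qed

end
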